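(* For every skew shape $\lambda/\mu$ there exists an involution $\Phi$ on $\mathrm{SVRPP}^{12}(\lambda/\mu)$ such that for all $T$: $\mathrm{ceq}(\Phi(T))=\mathrm{ceq}(T)$, $\mathrm{ex}(\Phi(T))=\mathrm{ex}(T)$, and $\mathrm{ircont}(\Phi(T))$ is obtained from $\mathrm{ircont}(T)$ by exchanging its first two entries.
   Context: Boxes are $(i,j)$ (row $i$, column $j$); $\lambda/\mu$ is the skew diagram. An SVRPP of shape $\lambda/\mu$ is a filling $T$ by nonempty finite sets $T(i,j)$ of positive integers, weakly increasing along rows and down columns, where $A\le B$ means $\max A\le\min B$. $\mathrm{SVRPP}^{12}(\lambda/\mu)$ is the set of SVRPPs all of whose sets are subsets of $\{1,2\}$. $\mathrm{ircont}(T)=(r_1,r_2,\ldots)$, $r_k$ = number of columns containing a box whose set contains $k$; $\mathrm{ceq}(T)=(c_i)$, $c_i$ = number of boxes $(i,j)$ with $(i+1,j)\in\lambda/\mu$ and $\max T(i,j)=\min T(i+1,j)$; $\mathrm{ex}(T)=(e_i)$, $e_i=\sum_{(i,j)\in\lambda/\mu}(|T(i,j)|-1)$. *)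

theory Defs
  imports Main
begin

text \<open>Partitions are sequences \<open>lam 1 \<ge> lam 2 \<ge> \<dots>\<close> that are eventually zero. All
  sequences here are indexed from 1, and so are rows and columns; the value of a
  partition at 0 is never used.\<close>

definition is_partition :: "(nat \<Rightarrow> nat) \<Rightarrow> bool" where
  "is_partition lam \<longleftrightarrow>
     monotone_on {1..} (\<le>) (\<ge>) lam \<and> finite {i. 1 \<le> i \<and> lam i \<noteq> 0}"

definition is_skew_shape :: "(nat \<Rightarrow> nat) \<Rightarrow> (nat \<Rightarrow> nat) \<Rightarrow> bool" where
  "is_skew_shape lam mu \<longleftrightarrow>
     is_partition lam \<and> is_partition mu \<and> (\<forall>i\<ge>1. mu i \<le> lam i)"

definition skew_diagram :: "(nat \<Rightarrow> nat) \<Rightarrow> (nat \<Rightarrow> nat) \<Rightarrow> (nat \<times> nat) set" where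
  "skew_diagram lam mu = {(i, j). 1 \<le> i \<and> mu i < j \<and> j \<le> lam i}"

definition set_le :: "nat set \<Rightarrow> nat set \<Rightarrow> bool" where
  "set_le A B \<longleftrightarrow> Max A \<le> Min B"

text \<open>A filling of \<open>lam/mu\<close> is encoded as a function on all of \<open>nat \<times> nat\<close> with the
  value \<open>{}\<close> off the diagram, so that equality of fillings is equality of functions.\<close>

definition SVRPP :: "(nat \<Rightarrow> nat) \<Rightarrow> (nat \<Rightarrow> nat) \<Rightarrow> (nat \<times> nat \<Rightarrow> nat set) set" where
  "SVRPP lam mu = {T.
     (\<forall>b \<in> skew_diagram lam mu. finite (T b) \<and> T b \<noteq> {} \<and> T b \<subseteq> {1..}) \<and>
     (\<forall>b. b \<notin> skew_diagram lam mu \<longrightarrow> T b = {}) \<and>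
     (\<forall>i j j'. (i, j) \<in> skew_diagram lam mu \<and> (i, j') \<in> skew_diagram lam mu \<and> j < j'
        \<longrightarrow> set_le (T (i, j)) (T (i, j'))) \<and>
     (\<forall>i i' j. (i, j) \<in> skew_diagram lam mu \<and> (i', j) \<in> skew_diagram lam mu \<and> i < i'
        \<longrightarrow> set_le (T (i, j)) (T (i', j)))}"

definition SVRPP12 :: "(nat \<Rightarrow> nat) \<Rightarrow> (nat \<Rightarrow> nat) \<Rightarrow> (nat \<times> nat \<Rightarrow> nat set) set" where
  "SVRPP12 lam mu = {T \<in> SVRPP lam mu. \<forall>b \<in> skew_diagram lam mu. T b \<subseteq> {1, 2}}"

definition ircont ::
  "(nat \<Rightarrow> nat) \<Rightarrow> (nat \<Rightarrow> nat) \<Rightarrow> (nat \<times> nat \<Rightarrow> nat set) \<Rightarrow> nat \<Rightarrow> nat" where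
  "ircont lam mu T k = card {j. \<exists>i. (i, j) \<in> skew_diagram lam mu \<and> k \<in> T (i, j)}"

definition ceq ::
  "(nat \<Rightarrow> nat) \<Rightarrow> (nat \<Rightarrow> nat) \<Rightarrow> (nat \<times> nat \<Rightarrow> nat set) \<Rightarrow> nat \<Rightarrow> nat" where
  "ceq lam mu T i = card {j. (i, j) \<in> skew_diagram lam mu \<and> (i + 1, j) \<in> skew_diagram lam mu
     \<and> Max (T (i, j)) = Min (T (i + 1, j))}"

definition ex ::
  "(nat \<Rightarrow> nat) \<Rightarrow> (nat \<Rightarrow> nat) \<Rightarrow> (nat \<times> nat \<Rightarrow> nat set) \<Rightarrow> nat \<Rightarrow> nat" where
  "ex lam mu T i = (\<Sum>j | (i, j) \<in> skew_diagram lam mu. card (T (i, j)) - 1)"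

end

theory Submission
  imports Defs
begin

text \<open>A filling with entries in \<open>{1, 2}\<close> is determined by the place \<open>t j\<close> at which column \<open>j\<close>
  changes from 1 to 2. If the places between rows are encoded by odd numbers and the boxes by even
  ones, then \<open>t j\<close> ranges over an interval with odd ends \<open>lo j\<close> (only 2s) and \<open>hi j\<close> (only 1s),
  and the row condition says that \<open>t\<close> is weakly decreasing and strictly decreasing at even values.
  The involution exchanges \<open>lo j\<close> and \<open>hi j\<close> in all columns and then resolves descents between
  adjacent columns by exchanging their contents, as long as possible. Resolution terminates and
  is locally confluent, so normal forms are unique. The exchange turns a resolution step into a
  reversed one; hence resolving, exchanging and resolving again leads back to \<open>t\<close>.
  Resolution keeps the multiset of mixed columns and the numbers of pure ones.\<close>

section \<open>Abstract rewriting: confluence from termination and local confluence\<close>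

lemma newman:
  assumes wf: "wfp (r\<inverse>\<inverse>)"
    and local: "\<And>x y z. r x y \<Longrightarrow> r x z \<Longrightarrow> \<exists>w. r\<^sup>*\<^sup>* y w \<and> r\<^sup>*\<^sup>* z w"
    and "r\<^sup>*\<^sup>* x y" "r\<^sup>*\<^sup>* x z"
  shows "\<exists>w. r\<^sup>*\<^sup>* y w \<and> r\<^sup>*\<^sup>* z w"
  using wf assms(3,4)
proof (induction x arbitrary: y z rule: wfp_induct_rule)
  case (less x)
  show ?case
  proof (cases "x = y \<or> x = z")
    case True
    then show ?thesis using less.prems by blast
  next
    case False
    then obtain y1 z1 where y1: "r x y1" "r\<^sup>*\<^sup>* y1 y" and z1: "r x z1" "r\<^sup>*\<^sup>* z1 z"
      using less.prems by (metis converse_rtranclpE)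
    obtain w where w: "r\<^sup>*\<^sup>* y1 w" "r\<^sup>*\<^sup>* z1 w"
      using local y1(1) z1(1) by blast
    obtain u where u: "r\<^sup>*\<^sup>* y u" "r\<^sup>*\<^sup>* w u"
      using less.IH[of y1 y w] y1 w by auto
    obtain v where v: "r\<^sup>*\<^sup>* u v" "r\<^sup>*\<^sup>* z v"
      using less.IH[of z1 u z] z1 w(2) u(2) by (meson conversepI rtranclp_trans)
    show ?thesis using u v by (meson rtranclp_trans)
  qed
qed

section \<open>Transition sequences and the resolution of descents\<close>

locale column_bounds =
  fixes lo hi :: "nat \<Rightarrow> nat" and N :: nat
  assumes antimono_lo: "antimono lo"
    and antimono_hi: "antimono hi"
    and lo_le_hi: "lo j \<le> hi j"
    and odd_lo: "odd (lo j)"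
    and odd_hi: "odd (hi j)"
    and lo_eq_hi: "N \<le> j \<Longrightarrow> lo j = hi j"
begin

text \<open>For a transition \<open>v\<close> this means that column \<open>j\<close> is mixed. The
  predicate is also applied to arbitrary \<open>v\<close>: an even value then stands for a box of
  column \<open>j\<close>, an odd one for two vertically adjacent boxes.\<close>

definition inner :: "nat \<Rightarrow> nat \<Rightarrow> bool" where
  "inner j v \<longleftrightarrow> lo j < v \<and> v < hi j"

definition bounded :: "(nat \<Rightarrow> nat) \<Rightarrow> bool" where
  "bounded t \<longleftrightarrow> (\<forall>j. lo j \<le> t j \<and> t j \<le> hi j)"

text \<open>The row condition for a left column with transition \<open>x\<close> and a right one
  with transition \<open>y\<close>: no row has a 2 on the left and a 1 on the right. Rows outside
  the diagram do no harm, since the bounds are odd and decreasing.\<close>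

definition separated :: "nat \<Rightarrow> nat \<Rightarrow> bool" where
  "separated x y \<longleftrightarrow> (\<forall>r. \<not> (x \<le> 2 * r \<and> 2 * r \<le> y))"

text \<open>The row condition is kept for mixed columns only, because \<open>flip\<close> may
  destroy it where pure columns are involved.\<close>

definition benign :: "(nat \<Rightarrow> nat) \<Rightarrow> bool" where
  "benign t \<longleftrightarrow> bounded t \<and>
     (\<forall>i j. i < j \<longrightarrow> inner i (t i) \<longrightarrow> inner j (t j) \<longrightarrow> separated (t i) (t j))"

definition valid :: "(nat \<Rightarrow> nat) \<Rightarrow> bool" where
  "valid t \<longleftrightarrow> bounded t \<and> (\<forall>i j. i < j \<longrightarrow> separated (t i) (t j))"

definition flip :: "(nat \<Rightarrow> nat) \<Rightarrow> nat \<Rightarrow> nat" where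
  "flip t j = (if t j = lo j then hi j else if t j = hi j then lo j else t j)"

text \<open>Not a plain swap: pure columns have to stay pure, so an end of one interval is carried
  to the same end of the other. At a descent the left value is never \<open>hi j\<close> and the
  right one never \<open>lo (Suc j)\<close>, which leaves the two ends treated here.\<close>

definition resolve :: "nat \<Rightarrow> (nat \<Rightarrow> nat) \<Rightarrow> nat \<Rightarrow> nat" where
  "resolve j t = t(j := if t (Suc j) = hi (Suc j) then hi j else t (Suc j),
     Suc j := if t j = lo j then lo (Suc j) else t j)"

definition step :: "(nat \<Rightarrow> nat) \<Rightarrow> (nat \<Rightarrow> nat) \<Rightarrow> bool" where
  "step t u \<longleftrightarrow> benign t \<and> (\<exists>j. t j < t (Suc j) \<and> u = resolve j t)"

text \<open>If \<open>x \<le> y\<close>, some even number lies between them unless both are the same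
  odd number.\<close>

lemma separated_iff: "separated x y \<longleftrightarrow> y < x \<or> (x = y \<and> odd x)"
proof
  assume "separated x y"
  \<comment> \<open>\<open>2 * (Suc x div 2)\<close> is the least even number that is at least
    \<open>x\<close>.\<close>
  then have "\<not> (x \<le> 2 * (Suc x div 2) \<and> 2 * (Suc x div 2) \<le> y)"
    unfolding separated_def by blast
  then show "y < x \<or> (x = y \<and> odd x)" by presburger
next
  assume "y < x \<or> (x = y \<and> odd x)"
  then show "separated x y" unfolding separated_def by presburger
qed

lemma lo_Suc: "lo (Suc j) \<le> lo j"
  using antimono_lo by (simp add: antimonoD)

lemma hi_Suc: "hi (Suc j) \<le> hi j"
  using antimono_hi by (simp add: antimonoD)

lemma boundedD: "bounded t \<Longrightarrow> lo j \<le> t j \<and> t j \<le> hi j"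
  by (simp add: bounded_def)

text \<open>As the bounds decrease, the left column of a descent is not all 1s and the right one not
  all 2s; two mixed columns would contradict \<open>benign\<close>. A participating inner value is
  inner for both columns, so it stays inner when moved.\<close>

lemma descent_cases:
  assumes "benign t" "t j < t (Suc j)"
  obtains (low_mid) "t j = lo j" "inner j (t (Suc j))" "inner (Suc j) (t (Suc j))"
      "resolve j t = t(j := t (Suc j), Suc j := lo (Suc j))"
  | (mid_high) "inner j (t j)" "inner (Suc j) (t j)" "t (Suc j) = hi (Suc j)"
      "resolve j t = t(j := hi j, Suc j := t j)"
  | (low_high) "t j = lo j" "t (Suc j) = hi (Suc j)" "lo j < hi (Suc j)"
      "resolve j t = t(j := hi j, Suc j := lo (Suc j))"
proof -
  have b: "lo j \<le> t j" "t (Suc j) \<le> hi (Suc j)"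
    using assms(1) boundedD unfolding benign_def by blast+
  have mid: "\<not> (inner j (t j) \<and> inner (Suc j) (t (Suc j)))"
    using assms unfolding benign_def separated_iff
    by (metis lessI less_asym nat_less_le)
  have ineqs: "lo (Suc j) \<le> lo j" "hi (Suc j) \<le> hi j" "t j < hi j" "lo (Suc j) < t (Suc j)"
    using b assms(2) lo_Suc[of j] hi_Suc[of j] by linarith+
  show thesis
  proof (cases "t j = lo j")
    case low: True
    show thesis
    proof (cases "t (Suc j) = hi (Suc j)")
      case True
      then show thesis using low_high low assms(2) by (simp add: resolve_def)
    next
      case False
      then show thesis using low_mid low b ineqs assms(2) by (simp add: resolve_def inner_def)
    qed
  next
    case False
    then have "inner j (t j)" using b ineqs by (simp add: inner_def)
    moreover have "t (Suc j) = hi (Suc j)"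
      using mid calculation b ineqs by (auto simp: inner_def)
    ultimately show thesis
      using mid_high False ineqs assms(2) by (simp add: resolve_def inner_def)
  qed
qed

lemma descent_less:
  assumes "bounded t" "t j < t (Suc j)"
  shows "lo j < hi j" "lo (Suc j) < hi (Suc j)" "Suc j < N"
proof -
  have "lo j \<le> t j" "t (Suc j) \<le> hi (Suc j)"
    using assms(1) boundedD by blast+
  then show "lo j < hi j" and *: "lo (Suc j) < hi (Suc j)"
    using assms(2) lo_Suc[of j] hi_Suc[of j] by linarith+
  show "Suc j < N" using * lo_eq_hi[of "Suc j"] by linarith
qed

lemma bounded_resolve:
  assumes "benign t" "t j < t (Suc j)"
  shows "bounded (resolve j t)"
  using assms
proof (cases rule: descent_cases)
qed (use assms(1) lo_le_hi in \<open>auto simp: bounded_def benign_def inner_def\<close>)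

text \<open>At most one of the two columns is mixed, and it only moves past a pure one; the order of
  the inner values from left to right is unchanged.\<close>

lemma benign_resolve:
  assumes "benign t" "t j < t (Suc j)"
  shows "benign (resolve j t)"
proof -
  let ?u = "resolve j t"
  have t: "separated (t k) (t l)" if "k < l" "inner k (t k)" "inner l (t l)" for k l
    using assms(1) that unfolding benign_def by blast
  have "separated (?u k) (?u l)" if "k < l" and k: "inner k (?u k)" and l: "inner l (?u l)" for k l
    using assms
  proof (cases rule: descent_cases)
    case low_mid
    then have "l \<noteq> Suc j" "k \<noteq> Suc j" using k l by (auto simp: inner_def)
    then show ?thesis
      using low_mid t[of k l] t[of "Suc j" l] t[of k "Suc j"] that
      by (auto split: if_splits)
  next
    case mid_high
    then have "l \<noteq> j" "k \<noteq> j" using k l by (auto simp: inner_def)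
    then show ?thesis
      using mid_high t[of k l] t[of "j" l] t[of k "j"] that
      by (auto split: if_splits)
  next
    case low_high
    then have "l \<noteq> j" "k \<noteq> j" "l \<noteq> Suc j" "k \<noteq> Suc j" using k l by (auto simp: inner_def)
    then show ?thesis
      using low_high t[of k l] that by auto
  qed
  then show ?thesis
    using bounded_resolve[OF assms] unfolding benign_def by blast
qed

text \<open>Only two summands change; they are added on opposite sides to avoid subtraction of
  naturals. Both the termination measure and the column counts are such sums.\<close>

lemma sum_resolve:
  fixes f :: "nat \<Rightarrow> nat \<Rightarrow> nat"
  assumes "Suc j < N"
  shows "(\<Sum>k<N. f k (resolve j t k)) + f j (t j) + f (Suc j) (t (Suc j)) =
    (\<Sum>k<N. f k (t k)) + f j (resolve j t j) + f (Suc j) (resolve j t (Suc j))"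
proof -
  have split: "(\<Sum>k<N. g k) = (\<Sum>k\<in>{..<N} - {j, Suc j}. g k) + g j + g (Suc j)"
    for g :: "nat \<Rightarrow> nat"
  proof -
    have "(\<Sum>k<N. g k) = (\<Sum>k\<in>{..<N} - {j, Suc j}. g k) + (\<Sum>k\<in>{j, Suc j}. g k)"
      using assms by (intro sum.subset_diff) auto
    then show ?thesis by simp
  qed
  have "(\<Sum>k\<in>{..<N} - {j, Suc j}. f k (resolve j t k)) = (\<Sum>k\<in>{..<N} - {j, Suc j}. f k (t k))"
    by (rule sum.cong) (auto simp: resolve_def)
  then show ?thesis
    using split[of "\<lambda>k. f k (resolve j t k)"] split[of "\<lambda>k. f k (t k)"] by simp
qed

section \<open>Termination of resolution\<close>

text \<open>Columns of 2s weigh 2, mixed ones 1, columns of 1s 0, and the factor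
  \<open>N - k\<close> is larger further to the left. A resolution moves the heavier of two columns
  one place to the right.\<close>

definition potential :: "(nat \<Rightarrow> nat) \<Rightarrow> nat" where
  "potential t = (\<Sum>k<N. (N - k) * (if t k = lo k then 2 else if t k = hi k then 0 else 1))"

lemma potential_resolve:
  assumes "benign t" "t j < t (Suc j)"
  shows "potential (resolve j t) < potential t"
proof -
  note d = descent_less[OF _ assms(2)]
  have b: "bounded t" using assms(1) by (simp add: benign_def)
  obtain n where n: "N - j = Suc (Suc n)" "N - Suc j = Suc n"
    using d(3)[OF b] by (metis Suc_diff_Suc Suc_lessD)
  define w :: "nat \<Rightarrow> nat \<Rightarrow> nat"
    where "w k v = (if v = lo k then 2 else if v = hi k then 0 else 1)" for k v
  have "potential u = (\<Sum>k<N. (N - k) * w k (u k))" for u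
    by (simp add: potential_def w_def)
  then have s: "potential (resolve j t) + (N - j) * w j (t j) + (N - Suc j) * w (Suc j) (t (Suc j)) =
    potential t + (N - j) * w j (resolve j t j) + (N - Suc j) * w (Suc j) (resolve j t (Suc j))"
    using sum_resolve[OF d(3)[OF b], of "\<lambda>k v. (N - k) * w k v" t] by simp
  show ?thesis
    using assms
  proof (cases rule: descent_cases)
  qed (use s d(1,2)[OF b] in \<open>auto simp: w_def n inner_def\<close>)
qed

lemma wfp_step: "wfp (step\<inverse>\<inverse>)"
  by (rule wfp_if_convertible_to_nat[where f = potential])
    (auto simp: step_def potential_resolve)

lemma stepI: "benign t \<Longrightarrow> t j < t (Suc j) \<Longrightarrow> step t (resolve j t)"
  unfolding step_def by blast

lemma step_benign: "step t u \<Longrightarrow> benign u"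
  unfolding step_def using benign_resolve by blast

section \<open>Local confluence\<close>

lemma resolve_commute:
  assumes "Suc j < k"
  shows "resolve j (resolve k t) = resolve k (resolve j t)"
  using assms by (auto simp: resolve_def fun_eq_iff)

text \<open>Descents at disjoint pairs of columns survive each other's resolution, and the
  resolutions commute.\<close>

lemma local_confluence_far:
  assumes "benign t" "t j < t (Suc j)" "t k < t (Suc k)" "Suc j < k"
  shows "\<exists>w. step\<^sup>*\<^sup>* (resolve j t) w \<and> step\<^sup>*\<^sup>* (resolve k t) w"
proof -
  have "step (resolve j t) (resolve k (resolve j t))"
    by (rule stepI[OF benign_resolve[OF assms(1,2)]]) (use assms(3,4) in \<open>auto simp: resolve_def\<close>)
  moreover have "step (resolve k t) (resolve j (resolve k t))"
    by (rule stepI[OF benign_resolve[OF assms(1,3)]]) (use assms(2,4) in \<open>auto simp: resolve_def\<close>)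
  ultimately show ?thesis
    using resolve_commute[OF assms(4)] by (metis r_into_rtranclp)
qed

text \<open>Two overlapping descents are necessarily of the form (low, inner, high), and both
  orders of resolution end in (high, inner, low).\<close>

lemma local_confluence_near:
  assumes "benign t" "t j < t (Suc j)" "t (Suc j) < t (Suc (Suc j))"
  shows "\<exists>w. step\<^sup>*\<^sup>* (resolve j t) w \<and> step\<^sup>*\<^sup>* (resolve (Suc j) t) w"
proof -
  let ?a = "j" and ?b = "Suc j" and ?c = "Suc (Suc j)"
  have b: "bounded t" using assms(1) by (simp add: benign_def)
  have bd: "lo ?a \<le> t ?a" "t ?c \<le> hi ?c"
    using boundedD[OF b] by blast+
  have mid: "inner ?b (t ?b)"
    unfolding inner_def using bd assms(2,3) lo_Suc[of j] hi_Suc[of ?b] by linarith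
  have low: "t ?a = lo ?a"
    using assms(1,2) by (cases rule: descent_cases) (use mid in \<open>auto simp: inner_def\<close>)
  have high: "t ?c = hi ?c"
    using assms(1,3) by (cases rule: descent_cases) (use mid in \<open>auto simp: inner_def\<close>)
  have m: "lo ?c \<le> lo ?b" "lo ?b \<le> lo ?a" "lo ?a < t ?b" "t ?b < hi ?c" "hi ?c \<le> hi ?b" "hi ?b \<le> hi ?a"
    using assms(2,3) low high lo_Suc hi_Suc by auto
  let ?t1 = "resolve ?a t" and ?u1 = "resolve ?b t"
  let ?t2 = "resolve ?b ?t1" and ?u2 = "resolve ?a ?u1"
  have t1: "benign ?t1" and u1: "benign ?u1"
    using assms benign_resolve by blast+
  have d2: "?t1 ?b < ?t1 ?c" "?u1 ?a < ?u1 ?b"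
    using low high m by (auto simp: resolve_def)
  have t2: "benign ?t2" and u2: "benign ?u2"
    using t1 u1 d2 benign_resolve by blast+
  have d3: "?t2 ?a < ?t2 ?b" "?u2 ?b < ?u2 ?c"
    using low high m by (auto simp: resolve_def)
  have "resolve ?a ?t2 = resolve ?b ?u2"
    using low high m by (auto simp: resolve_def fun_eq_iff)
  moreover have "step\<^sup>*\<^sup>* ?t1 (resolve ?a ?t2)"
    using stepI[OF t1 d2(1)] stepI[OF t2 d3(1)] by auto
  moreover have "step\<^sup>*\<^sup>* ?u1 (resolve ?b ?u2)"
    using stepI[OF u1 d2(2)] stepI[OF u2 d3(2)] by auto
  ultimately show ?thesis by auto
qed

lemma local_confluence:
  assumes "step t u" "step t v"
  shows "\<exists>w. step\<^sup>*\<^sup>* u w \<and> step\<^sup>*\<^sup>* v w"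
proof -
  obtain j k where t: "benign t" and j: "t j < t (Suc j)" "u = resolve j t"
    and k: "t k < t (Suc k)" "v = resolve k t"
    using assms unfolding step_def by blast
  consider "j = k" | "k = Suc j" | "j = Suc k" | "Suc j < k" | "Suc k < j" by linarith
  then show ?thesis
  proof cases
    case 1
    then show ?thesis using j k by auto
  next
    case 2
    then show ?thesis using local_confluence_near[OF t j(1)] j k by auto
  next
    case 3
    then show ?thesis using local_confluence_near[OF t k(1)] j k by auto
  next
    case 4
    then show ?thesis using local_confluence_far[OF t j(1) k(1)] j k by auto
  next
    case 5
    then show ?thesis using local_confluence_far[OF t k(1) j(1)] j k by auto
  qed
qed

section \<open>Normal forms\<close>

lemma valid_benign: "valid t \<Longrightarrow> benign t"
  unfolding valid_def benign_def by blast

text \<open>Without descents the sequence is weakly decreasing. Two equal even values would both be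
  inner, as the ends are odd, and \<open>benign\<close> excludes this.\<close>

lemma valid_iff_no_step: "valid t \<longleftrightarrow> benign t \<and> (\<forall>u. \<not> step t u)"
proof
  assume t: "valid t"
  then have "\<not> t j < t (Suc j)" for j
    unfolding valid_def separated_iff by (metis lessI less_asym less_irrefl)
  then show "benign t \<and> (\<forall>u. \<not> step t u)"
    using t valid_benign unfolding step_def by blast
next
  assume t: "benign t \<and> (\<forall>u. \<not> step t u)"
  then have "t (Suc j) \<le> t j" for j
    using stepI not_le by blast
  then have mono: "t j \<le> t i" if "i < j" for i j
    using lift_Suc_antimono_le[of t i j] that by simp
  have "separated (t i) (t j)" if "i < j" for i j
  proof (cases "inner i (t i) \<and> inner j (t j)")
    case True
    then show ?thesis using t that unfolding benign_def by blast
  next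
    case False
    \<comment> \<open>A value that is not inner is an end of its interval.\<close>
    then have "odd (t i) \<or> odd (t j)"
      using t boundedD[of t] odd_lo odd_hi unfolding inner_def benign_def
      by (metis nat_less_le)
    then show ?thesis
      using mono[OF that] unfolding separated_iff by auto
  qed
  then show "valid t" using t unfolding valid_def benign_def by blast
qed

lemma normal_form_unique:
  assumes "step\<^sup>*\<^sup>* t u" "step\<^sup>*\<^sup>* t v" "valid u" "valid v"
  shows "u = v"
proof -
  obtain w where "step\<^sup>*\<^sup>* u w" "step\<^sup>*\<^sup>* v w"
    using newman[OF wfp_step _ assms(1,2)] local_confluence by blast
  then show ?thesis
    using assms(3,4) valid_iff_no_step by (metis converse_rtranclpE)
qed

lemma normal_form_exists:
  assumes "benign t"
  shows "\<exists>u. step\<^sup>*\<^sup>* t u \<and> valid u"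
  using wfp_step assms
proof (induction t rule: wfp_induct_rule)
  case (less t)
  show ?case
  proof (cases "\<exists>u. step t u")
    case True
    then obtain u where u: "step t u" by blast
    then obtain v where "step\<^sup>*\<^sup>* u v" "valid v"
      using less.IH[of u] step_benign by auto
    then show ?thesis using u by (meson converse_rtranclp_into_rtranclp)
  next
    case False
    then show ?thesis using less.prems valid_iff_no_step by blast
  qed
qed

definition normal_form :: "(nat \<Rightarrow> nat) \<Rightarrow> nat \<Rightarrow> nat" where
  "normal_form t = (THE u. step\<^sup>*\<^sup>* t u \<and> valid u)"

lemma normal_form_eq: "step\<^sup>*\<^sup>* t u \<Longrightarrow> valid u \<Longrightarrow> normal_form t = u"
  unfolding normal_form_def using normal_form_unique by blast

lemma normal_form:
  assumes "benign t"
  shows "step\<^sup>*\<^sup>* t (normal_form t)" "valid (normal_form t)"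
  using normal_form_exists[OF assms] normal_form_eq by auto

section \<open>The exchange of ends and the involution on valid sequences\<close>

lemma inner_flip: "inner j (flip t j) \<Longrightarrow> flip t j = t j"
  by (auto simp: flip_def inner_def split: if_splits)

lemma flip_flip: "flip (flip t) = t"
  by (auto simp: flip_def fun_eq_iff)

lemma benign_flip:
  assumes "benign t"
  shows "benign (flip t)"
proof -
  have "bounded (flip t)"
    using assms lo_le_hi by (auto simp: benign_def bounded_def flip_def)
  moreover have "separated (flip t i) (flip t j)"
    if "i < j" "inner i (flip t i)" "inner j (flip t j)" for i j
    using assms that inner_flip[of i t] inner_flip[of j t] by (simp add: benign_def)
  ultimately show ?thesis unfolding benign_def by blast
qed

text \<open>For instance, (low, inner) resolves to (inner, low), which \<open>flip\<close> turns
  into the descent (inner, high); this resolves to (high, inner), the flip of the start. So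
  \<open>low_mid\<close> and \<open>mid_high\<close> change roles, while \<open>low_high\<close>
  corresponds to itself.\<close>

lemma step_flip:
  assumes "step t u"
  shows "step (flip u) (flip t)"
proof -
  obtain j where t: "benign t" and j: "t j < t (Suc j)" and u: "u = resolve j t"
    using assms unfolding step_def by blast
  have b: "bounded t" using t by (simp add: benign_def)
  note d = descent_less[OF b j]
  have "flip u j < flip u (Suc j) \<and> (\<forall>k. resolve j (flip u) k = flip t k)"
    using t j
  proof (cases rule: descent_cases)
    case low_mid
    note u = u[unfolded low_mid(4)]
    show ?thesis using low_mid(1-3) d by (simp add: u flip_def resolve_def inner_def)
  next
    case mid_high
    note u = u[unfolded mid_high(4)]
    show ?thesis using mid_high(1-3) d by (simp add: u flip_def resolve_def inner_def)
  next
    case low_high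
    note u = u[unfolded low_high(4)]
    show ?thesis using low_high(1-3) d by (simp add: u flip_def resolve_def inner_def)
  qed
  then have "flip u j < flip u (Suc j)" "resolve j (flip u) = flip t"
    by blast+
  moreover have "benign (flip u)"
    using assms step_benign benign_flip by blast
  ultimately show ?thesis using stepI[of "flip u" j] by simp
qed

lemma steps_flip: "step\<^sup>*\<^sup>* t u \<Longrightarrow> step\<^sup>*\<^sup>* (flip u) (flip t)"
  by (induction rule: rtranclp_induct) (auto dest: step_flip intro: converse_rtranclp_into_rtranclp)

definition switch :: "(nat \<Rightarrow> nat) \<Rightarrow> nat \<Rightarrow> nat" where
  "switch t = normal_form (flip t)"

lemma switch:
  assumes "valid t"
  shows "step\<^sup>*\<^sup>* (flip t) (switch t)" "valid (switch t)"
  using normal_form benign_flip valid_benign assms unfolding switch_def by blast+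

text \<open>Reversing the resolution of \<open>flip t\<close> to \<open>switch t\<close> gives one
  of \<open>flip (switch t)\<close> to \<open>t\<close>, and \<open>t\<close> is already valid,
  hence the normal form.\<close>

lemma switch_switch:
  assumes "valid t"
  shows "switch (switch t) = t"
  using steps_flip[OF switch(1)[OF assms]] normal_form_eq assms
  unfolding switch_def by (simp add: flip_flip)

section \<open>Column counts under resolution and exchange\<close>

lemma card_columns:
  assumes "\<And>j v. P j v \<Longrightarrow> lo j < hi j"
  shows "card {j. P j (t j)} = (\<Sum>j<N. of_bool (P j (t j)))"
proof -
  have "j < N" if "P j (t j)" for j
    using assms[OF that] lo_eq_hi[of j] by (cases "j < N") auto
  then have "{j. P j (t j)} = {..<N} \<inter> {j. P j (t j)}" by auto
  then show ?thesis by simp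
qed

text \<open>The invariance principle for all statistics: it suffices to compare the two columns of a
  single descent.\<close>

lemma card_steps:
  assumes P: "\<And>j v. P j v \<Longrightarrow> lo j < hi j"
    and resolve: "\<And>j t. benign t \<Longrightarrow> t j < t (Suc j) \<Longrightarrow> lo j < hi j \<Longrightarrow> lo (Suc j) < hi (Suc j) \<Longrightarrow>
       of_bool (P j (resolve j t j)) + of_bool (P (Suc j) (resolve j t (Suc j))) =
       (of_bool (P j (t j)) + of_bool (P (Suc j) (t (Suc j))) :: nat)"
    and "step\<^sup>*\<^sup>* t u"
  shows "card {j. P j (u j)} = card {j. P j (t j)}"
  using assms(3)
proof (induction rule: rtranclp_induct)
  case (step u v)
  then obtain j where u: "benign u" and j: "u j < u (Suc j)" and v: "v = resolve j u"
    unfolding step_def by blast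
  have b: "bounded u" using u by (simp add: benign_def)
  have "card {j. P j (v j)} = card {j. P j (u j)}"
    using sum_resolve[OF descent_less(3)[OF b j], of "\<lambda>j v. of_bool (P j v)" u]
      resolve[OF u j descent_less(1,2)[OF b j]] card_columns[of P, OF P] v by simp
  then show ?case using step.IH by simp
qed simp

text \<open>Resolution keeps the number of columns of 2s, and \<open>flip\<close> makes them out of
  the columns of 1s. In terms of fillings, the columns with a 1 afterwards are as many as those with
  a 2 before.\<close>

lemma card_switch_lo:
  assumes "valid t"
  shows "card {j. lo j < hi j \<and> switch t j \<noteq> lo j} = card {j. lo j < hi j \<and> t j \<noteq> hi j}"
proof -
  have "card {j. lo j < hi j \<and> switch t j \<noteq> lo j} = card {j. lo j < hi j \<and> flip t j \<noteq> lo j}"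
  proof (rule card_steps[of "\<lambda>j v. lo j < hi j \<and> v \<noteq> lo j"])
    fix j and t :: "nat \<Rightarrow> nat"
    assume *: "lo j < hi j" "lo (Suc j) < hi (Suc j)" and "benign t" "t j < t (Suc j)"
    from this(3,4) show "of_bool (lo j < hi j \<and> resolve j t j \<noteq> lo j) +
        of_bool (lo (Suc j) < hi (Suc j) \<and> resolve j t (Suc j) \<noteq> lo (Suc j)) =
       (of_bool (lo j < hi j \<and> t j \<noteq> lo j) + of_bool (lo (Suc j) < hi (Suc j) \<and> t (Suc j) \<noteq> lo (Suc j)) :: nat)"
      by (cases rule: descent_cases) (use * in \<open>auto simp: inner_def\<close>)
  qed (use switch[OF assms] in auto)
  also have "{j. lo j < hi j \<and> flip t j \<noteq> lo j} = {j. lo j < hi j \<and> t j \<noteq> hi j}"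
    by (auto simp: flip_def)
  finally show ?thesis .
qed

text \<open>This is \<open>card_switch_lo\<close> for \<open>switch t\<close>, read backwards
  through the involution.\<close>

lemma card_switch_hi:
  assumes "valid t"
  shows "card {j. lo j < hi j \<and> switch t j \<noteq> hi j} = card {j. lo j < hi j \<and> t j \<noteq> lo j}"
  using card_switch_lo[OF switch(2)[OF assms]] switch_switch[OF assms] by simp

text \<open>Inner values are fixed by \<open>flip\<close> and move only to columns where they are
  inner too. The parameter \<open>b\<close> covers two statistics at once: \<open>True\<close> with
  even \<open>c\<close> serves \<open>ex\<close>, \<open>False\<close> with odd \<open>c\<close>
  serves \<open>ceq\<close>.\<close>

lemma card_switch_inner:
  assumes "valid t"
  shows "card {j. inner j c \<and> (switch t j = c) = b} = card {j. inner j c \<and> (t j = c) = b}"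
proof -
  have "card {j. inner j c \<and> (switch t j = c) = b} = card {j. inner j c \<and> (flip t j = c) = b}"
  proof (rule card_steps[of "\<lambda>j v. inner j c \<and> (v = c) = b"])
    fix j and t :: "nat \<Rightarrow> nat"
    assume "benign t" "t j < t (Suc j)"
    then show "of_bool (inner j c \<and> (resolve j t j = c) = b) +
        of_bool (inner (Suc j) c \<and> (resolve j t (Suc j) = c) = b) =
       (of_bool (inner j c \<and> (t j = c) = b) + of_bool (inner (Suc j) c \<and> (t (Suc j) = c) = b) :: nat)"
      by (cases rule: descent_cases) (auto simp: inner_def)
  qed (use switch[OF assms] in \<open>auto simp: inner_def\<close>)
  also have "{j. inner j c \<and> (flip t j = c) = b} = {j. inner j c \<and> (t j = c) = b}"
    by (auto simp: flip_def inner_def)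
  finally show ?thesis .
qed

end

section \<open>Conjugate partitions and the entries of a column\<close>

text \<open>The conjugate partition with its index shifted: the value at \<open>j\<close> is the
  length of column \<open>j + 1\<close>.\<close>

definition conjugate :: "(nat \<Rightarrow> nat) \<Rightarrow> nat \<Rightarrow> nat" where
  "conjugate p j = card {i. 1 \<le> i \<and> j < p i}"

lemma finite_conjugate: "is_partition p \<Longrightarrow> finite {i. 1 \<le> i \<and> j < p i}"
  unfolding is_partition_def by (rule finite_subset[of _ "{i. 1 \<le> i \<and> p i \<noteq> 0}"]) auto

lemma partition_le: "is_partition p \<Longrightarrow> 1 \<le> i \<Longrightarrow> i \<le> k \<Longrightarrow> p k \<le> p i"
  unfolding is_partition_def monotone_on_def by auto

text \<open>Since \<open>p\<close> decreases, the rows reaching beyond column \<open>j\<close> form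
  an initial segment of the rows.\<close>

lemma le_conjugate_iff:
  assumes p: "is_partition p" and i: "1 \<le> i"
  shows "i \<le> conjugate p j \<longleftrightarrow> j < p i"
proof
  assume "j < p i"
  then have "j < p k" if "k \<in> {1..i}" for k
    using partition_le[OF p, of k i] that by auto
  then have "{1..i} \<subseteq> {k. 1 \<le> k \<and> j < p k}" by auto
  then show "i \<le> conjugate p j"
    using card_mono[OF finite_conjugate[OF p], of "{1..i}" j] unfolding conjugate_def by simp
next
  assume le: "i \<le> conjugate p j"
  show "j < p i"
  proof (rule ccontr)
    assume ge: "\<not> j < p i"
    have "k < i" if "j < p k" for k
      using partition_le[OF p i, of k] that ge by (cases "i \<le> k") auto
    then have "{k. 1 \<le> k \<and> j < p k} \<subseteq> {1..<i}" by auto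
    then have "conjugate p j \<le> card {1..<i}"
      unfolding conjugate_def by (intro card_mono) auto
    then show False using le i by simp
  qed
qed

lemma antimono_conjugate: "is_partition p \<Longrightarrow> antimono (conjugate p)"
  unfolding conjugate_def by (intro antimonoI card_mono finite_conjugate) auto

text \<open>The entry in row \<open>i\<close> of a column is determined by the place \<open>x\<close> where the column changes
  from 1 to 2: \<open>x = 2 * i\<close> if row \<open>i\<close> contains both, \<open>x = 2 * i + 1\<close> if the change happens
  between rows \<open>i\<close> and \<open>i + 1\<close>.\<close>

definition box :: "nat \<Rightarrow> nat \<Rightarrow> nat set" where
  "box i x = (if 2 * i < x then {1} else if x < 2 * i then {2} else {1, 2})"

lemma one_in_box: "1 \<in> box i x \<longleftrightarrow> 2 * i \<le> x"
  and two_in_box: "2 \<in> box i x \<longleftrightarrow> x \<le> 2 * i"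
  by (auto simp: box_def)

lemma Max_box: "Max (box i x) = (if x \<le> 2 * i then 2 else 1)"
  and Min_box: "Min (box i x) = (if 2 * i \<le> x then 1 else 2)"
  by (auto simp: box_def)

text \<open>The comparison fails only for a 2 in the first box and a 1 in the second. For
  \<open>i = k\<close> this is the condition inside \<open>separated\<close>.\<close>

lemma set_le_box: "set_le (box i x) (box k y) \<longleftrightarrow> \<not> (x \<le> 2 * i \<and> 2 * k \<le> y)"
  by (simp add: set_le_def Max_box Min_box)

lemma card_box: "card (box i x) - 1 = of_bool (x = 2 * i)"
  by (simp add: box_def)

lemma Max_box_eq_Min_box_iff: "Max (box i x) = Min (box (i + 1) x) \<longleftrightarrow> x \<noteq> 2 * i + 1"
  by (auto simp: Max_box Min_box)

lemma set_le_12D: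
  assumes "set_le A B" "A \<subseteq> {1, 2}" "B \<subseteq> {1, 2}" "2 \<in> A"
  shows "1 \<notin> B"
proof
  assume "1 \<in> B"
  moreover have "finite A" "finite B"
    using assms(2,3) finite_subset by blast+
  ultimately have "2 \<le> Max A" "Min B \<le> 1" using assms(4) by auto
  then show False using assms(1) by (simp add: set_le_def)
qed

section \<open>Fillings as valid transition sequences\<close>

locale skew_shape =
  fixes lam mu :: "nat \<Rightarrow> nat"
  assumes skew: "is_skew_shape lam mu"
begin

lemma partition_lam: "is_partition lam"
  and partition_mu: "is_partition mu"
  and mu_le_lam: "1 \<le> i \<Longrightarrow> mu i \<le> lam i"
  using skew by (auto simp: is_skew_shape_def)

text \<open>Columns are shifted to start at 0. The values \<open>low j\<close> and \<open>high j\<close> encode the columns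
  consisting only of 2s and only of 1s; they agree if the column is empty.\<close>

definition low :: "nat \<Rightarrow> nat" where
  "low j = 2 * conjugate mu j + 1"

definition high :: "nat \<Rightarrow> nat" where
  "high j = 2 * conjugate lam j + 1"

sublocale column_bounds low high "lam 1"
proof
  show "antimono low"
    using antimono_conjugate[OF partition_mu] by (simp add: low_def monotone_def)
  show "antimono high"
    using antimono_conjugate[OF partition_lam] by (simp add: high_def monotone_def)
  fix j
  have "{i. 1 \<le> i \<and> j < mu i} \<subseteq> {i. 1 \<le> i \<and> j < lam i}"
    using mu_le_lam by (auto intro: less_le_trans)
  then show le: "low j \<le> high j"
    using card_mono[OF finite_conjugate[OF partition_lam]]
    by (simp add: low_def high_def conjugate_def)
  show "odd (low j)" "odd (high j)" by (simp_all add: low_def high_def)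
  \<comment> \<open>Row 1 is the longest, so columns from here on have no boxes.\<close>
  assume "lam 1 \<le> j"
  then have "conjugate lam j = 0"
    using le_conjugate_iff[OF partition_lam, of 1 j] by simp
  then show "low j = high j" using le by (simp add: low_def high_def)
qed

lemma Suc_in_diagram: "(i, Suc j) \<in> skew_diagram lam mu \<longleftrightarrow> inner j (2 * i)"
\<comment> \<open>\<open>le_conjugate_iff\<close> needs a row from 1 on; row 0 is outside the
  diagram, and \<open>low j\<close> is positive.\<close>
proof (cases "i = 0")
  case False
  then show ?thesis
    using le_conjugate_iff[OF partition_lam, of i j] le_conjugate_iff[OF partition_mu, of i j]
    by (auto simp: skew_diagram_def inner_def low_def high_def)
qed (simp add: skew_diagram_def inner_def)

lemma in_diagram: "(i, c) \<in> skew_diagram lam mu \<longleftrightarrow> (\<exists>j. c = Suc j \<and> inner j (2 * i))"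
  by (cases c) (auto simp: Suc_in_diagram, auto simp: skew_diagram_def)

text \<open>\<open>c - 1\<close> undoes the column shift; \<open>c = 0\<close> does not occur in the
  diagram.\<close>

definition decode :: "(nat \<Rightarrow> nat) \<Rightarrow> nat \<times> nat \<Rightarrow> nat set" where
  "decode t = (\<lambda>(i, c). if (i, c) \<in> skew_diagram lam mu then box i (t (c - 1)) else {})"

lemma decode_Suc: "inner j (2 * i) \<Longrightarrow> decode t (i, Suc j) = box i (t j)"
  by (simp add: decode_def Suc_in_diagram)

text \<open>Rows increase because the transitions are separated; columns increase for any
  transition.\<close>

lemma decode_in_SVRPP12:
  assumes "valid t"
  shows "decode t \<in> SVRPP12 lam mu"
proof -
  have "set_le (decode t (i, c)) (decode t (i, c'))"
    if "(i, c) \<in> skew_diagram lam mu" "(i, c') \<in> skew_diagram lam mu" "c < c'" for i c c'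
    using that assms
    by (auto simp: in_diagram decode_Suc set_le_box valid_def separated_def)
  moreover have "set_le (decode t (i, c)) (decode t (i', c))"
    if "(i, c) \<in> skew_diagram lam mu" "(i', c) \<in> skew_diagram lam mu" "i < i'" for i i' c
    using that by (auto simp: in_diagram decode_Suc set_le_box)
  moreover have "decode t b \<subseteq> {1, 2} \<and> finite (decode t b) \<and> decode t b \<noteq> {} \<and> decode t b \<subseteq> {1..}"
    if "b \<in> skew_diagram lam mu" for b
    using that by (cases b) (auto simp: decode_def box_def)
  moreover have "decode t b = {}" if "b \<notin> skew_diagram lam mu" for b
    using that by (cases b) (simp add: decode_def)
  ultimately show ?thesis
    unfolding SVRPP12_def SVRPP_def by blast
qed

text \<open>Two different transitions of one column have an even number \<open>2 * r\<close> between
  them (ends included), and the boxes in row \<open>r\<close> then differ.\<close>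

lemma inj_decode: "inj_on decode {t. valid t}"
proof (rule inj_onI, rule ext, rule ccontr)
  have *: False if eq: "decode t = decode u" and valid: "valid t" "valid u" and less: "t j < u j" for t u j
  proof -
    obtain r where r: "t j \<le> 2 * r" "2 * r \<le> u j"
      using less separated_iff[of "t j" "u j"] unfolding separated_def by auto
    have b: "low j \<le> t j" "u j \<le> high j"
      using valid boundedD unfolding valid_def by blast+
    \<comment> \<open>The ends are odd, so \<open>2 * r\<close> lies strictly inside and row
      \<open>r\<close> belongs to the column.\<close>
    have "low j \<noteq> 2 * r" "high j \<noteq> 2 * r"
      by (simp_all add: low_def high_def) presburger+
    then have "inner j (2 * r)"
      using r b unfolding inner_def by linarith
    then have "box r (t j) = box r (u j)"
      using eq decode_Suc[of j r t] decode_Suc[of j r u] by simp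
    then show False
      using r less by (auto simp: box_def split: if_splits)
  qed
  fix t u j
  assume "t \<in> {t. valid t}" "u \<in> {t. valid t}" "decode t = decode u" "t j \<noteq> u j"
  then show False
    using *[of t u j] *[of u t j] by (cases "t j < u j") auto
qed

lemma SVRPP12_entry:
  assumes "T \<in> SVRPP12 lam mu" "inner j (2 * i)"
  shows "T (i, Suc j) = {1} \<or> T (i, Suc j) = {2} \<or> T (i, Suc j) = {1, 2}"
proof -
  have "(i, Suc j) \<in> skew_diagram lam mu" using assms(2) by (simp add: Suc_in_diagram)
  then have "T (i, Suc j) \<subseteq> {1, 2}" "T (i, Suc j) \<noteq> {}"
    using assms(1) unfolding SVRPP12_def SVRPP_def by auto
  then show ?thesis by blast
qed

lemma SVRPP12_row:
  assumes "T \<in> SVRPP12 lam mu" "inner j (2 * i)" "inner k (2 * i)" "j < k"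
  shows "set_le (T (i, Suc j)) (T (i, Suc k))"
  using assms by (simp add: SVRPP12_def SVRPP_def Suc_in_diagram)

lemma SVRPP12_column:
  assumes "T \<in> SVRPP12 lam mu" "inner j (2 * i)" "inner j (2 * k)" "i < k"
  shows "set_le (T (i, Suc j)) (T (k, Suc j))"
  using assms by (simp add: SVRPP12_def SVRPP_def Suc_in_diagram)

text \<open>The transition is read off at the last row \<open>r\<close> with a 1: it is
  \<open>2 * r\<close> if that box also has a 2, and \<open>2 * r + 1\<close> otherwise.\<close>

lemma column_transition:
  assumes "T \<in> SVRPP12 lam mu"
  shows "\<exists>x. low j \<le> x \<and> x \<le> high j \<and> (\<forall>i. inner j (2 * i) \<longrightarrow> T (i, Suc j) = box i x)"
proof -
  let ?g = "\<lambda>i. T (i, Suc j)"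
  note g = SVRPP12_entry[OF assms]
  have mono: "1 \<notin> ?g k" if "inner j (2 * i)" "inner j (2 * k)" "i < k" "2 \<in> ?g i" for i k
  proof (rule set_le_12D)
    show "set_le (?g i) (?g k)"
      using SVRPP12_column[OF assms] that by blast
    show "?g i \<subseteq> {1, 2}" "?g k \<subseteq> {1, 2}"
      using g[OF that(1)] g[OF that(2)] by auto
  qed (use that in auto)
  let ?S = "{i. inner j (2 * i) \<and> 1 \<in> ?g i}"
  show ?thesis
  proof (cases "?S = {}")
    case True
    \<comment> \<open>Without a 1 the column consists of 2s, or it is empty and the claim is
      vacuous.\<close>
    have "?g i = box i (low j)" if "inner j (2 * i)" for i
      using g[OF that] that True by (auto simp: box_def inner_def)
    then show ?thesis using lo_le_hi by blast
  next
    case False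
    have fin: "finite ?S"
      by (rule finite_subset[of _ "{..high j}"]) (auto simp: inner_def)
    define r where "r = Max ?S"
    have r: "inner j (2 * r)" "1 \<in> ?g r"
      using Max_in[OF fin False] unfolding r_def by auto
    have above: "1 \<notin> ?g i" if "inner j (2 * i)" "r < i" for i
      using Max_ge[OF fin, of i] that unfolding r_def by fastforce
    define x where "x = (if 2 \<in> ?g r then 2 * r else 2 * r + 1)"
    have "?g i = box i x" if i: "inner j (2 * i)" for i
    proof -
      consider "i < r" | "i = r" | "r < i" by linarith
      then show ?thesis
      proof cases
        case 1
        then have "2 \<notin> ?g i" using mono[OF i r(1)] r(2) by blast
        then show ?thesis using g[OF i] 1 by (auto simp: box_def x_def)
      next
        case 2
        then show ?thesis using g[OF i] r(2) by (auto simp: box_def x_def)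
      next
        case 3
        then show ?thesis using g[OF i] above[OF i] by (auto simp: box_def x_def)
      qed
    qed
    moreover have "low j \<le> x" "x \<le> high j"
      using r(1) by (auto simp: x_def inner_def)
    ultimately show ?thesis by blast
  qed
qed

text \<open>Transitions are chosen column by column. A failure of \<open>separated\<close> at
  \<open>r\<close> would put row \<open>r\<close> into both columns, by oddness and monotonicity of
  the bounds, and contradict the row condition there.\<close>

lemma SVRPP12_decode:
  assumes "T \<in> SVRPP12 lam mu"
  shows "\<exists>t. valid t \<and> decode t = T"
proof -
  obtain t where t: "\<And>j. low j \<le> t j" "\<And>j. t j \<le> high j"
      "\<And>i j. inner j (2 * i) \<Longrightarrow> T (i, Suc j) = box i (t j)"
    using column_transition[OF assms] by metis
  have "separated (t j) (t k)" if "j < k" for j k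
    unfolding separated_def
  proof (intro allI notI)
    fix r
    assume r: "t j \<le> 2 * r \<and> 2 * r \<le> t k"
    have "low j \<noteq> 2 * r" "high k \<noteq> 2 * r"
      by (simp_all add: low_def high_def) presburger+
    moreover have "low k \<le> low j" "high k \<le> high j"
      using that antimono_lo antimono_hi by (simp_all add: antimonoD)
    ultimately have *: "inner j (2 * r)" "inner k (2 * r)"
      using r t(1)[of j] t(2)[of k] unfolding inner_def by linarith+
    then have "set_le (T (r, Suc j)) (T (r, Suc k))"
      using SVRPP12_row[OF assms] that by blast
    then show False using r * t(3) by (simp add: set_le_box)
  qed
  then have "valid t" using t unfolding valid_def bounded_def by blast
  moreover have "decode t b = T b" for b
  proof (cases "b \<in> skew_diagram lam mu")
    case True
    then show ?thesis using t(3) by (cases b) (auto simp: in_diagram decode_Suc)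
  next
    case False
    then show ?thesis
      using assms by (cases b) (simp add: decode_def SVRPP12_def SVRPP_def)
  qed
  ultimately show ?thesis by blast
qed

section \<open>The statistics in terms of transitions\<close>

lemma ircont_decode:
  "ircont lam mu (decode t) k = card {j. \<exists>i. inner j (2 * i) \<and> k \<in> box i (t j)}"
proof -
  have "{c. \<exists>i. (i, c) \<in> skew_diagram lam mu \<and> k \<in> decode t (i, c)} =
      Suc ` {j. \<exists>i. inner j (2 * i) \<and> k \<in> box i (t j)}"
    by (auto simp: in_diagram decode_def intro!: imageI)
  then show ?thesis unfolding ircont_def by (simp add: card_image)
qed

lemma ircont_decode_1:
  assumes "valid t"
  shows "ircont lam mu (decode t) 1 = card {j. low j < high j \<and> t j \<noteq> low j}"
proof -
  have "(\<exists>i. inner j (2 * i) \<and> 2 * i \<le> t j) \<longleftrightarrow> low j < high j \<and> t j \<noteq> low j" for j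
  proof
    assume "low j < high j \<and> t j \<noteq> low j"
    \<comment> \<open>The witness is the top row of the column, which has a 1 unless the column is
      all 2s.\<close>
    then show "\<exists>i. inner j (2 * i) \<and> 2 * i \<le> t j"
      using assms boundedD[of t j] unfolding valid_def inner_def
      by (intro exI[of _ "conjugate mu j + 1"]) (auto simp: low_def high_def)
  qed (auto simp: inner_def)
  then show ?thesis unfolding ircont_decode one_in_box by simp
qed

lemma ircont_decode_2:
  assumes "valid t"
  shows "ircont lam mu (decode t) 2 = card {j. low j < high j \<and> t j \<noteq> high j}"
proof -
  have "(\<exists>i. inner j (2 * i) \<and> t j \<le> 2 * i) \<longleftrightarrow> low j < high j \<and> t j \<noteq> high j" for j
  proof
    assume "low j < high j \<and> t j \<noteq> high j"
    \<comment> \<open>Dually, the witness is the bottom row of the column.\<close>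
    then show "\<exists>i. inner j (2 * i) \<and> t j \<le> 2 * i"
      using assms boundedD[of t j] unfolding valid_def inner_def
      by (intro exI[of _ "conjugate lam j"]) (auto simp: low_def high_def)
  qed (auto simp: inner_def)
  then show ?thesis unfolding ircont_decode two_in_box by simp
qed

lemma ircont_decode_other:
  assumes "k \<noteq> 1" "k \<noteq> 2"
  shows "ircont lam mu (decode t) k = 0"
proof -
  have "k \<notin> box i x" for i x
    using assms by (simp add: box_def)
  then show ?thesis by (simp add: ircont_decode)
qed

text \<open>Vertical neighbours disagree only if the column changes exactly between them. The form
  \<open>= False\<close> matches \<open>card_switch_inner\<close>.\<close>

lemma ceq_decode:
  "ceq lam mu (decode t) i = card {j. inner j (2 * i + 1) \<and> (t j = 2 * i + 1) = False}"
proof -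
  \<comment> \<open>As the ends are odd, \<open>2 * i + 1\<close> is inner only together with both
    even neighbours.\<close>
  have both: "(i, Suc j) \<in> skew_diagram lam mu \<and> (i + 1, Suc j) \<in> skew_diagram lam mu \<longleftrightarrow>
      inner j (2 * i + 1)" for j
    unfolding Suc_in_diagram by (auto simp: inner_def low_def high_def)
  have "(i, c) \<in> skew_diagram lam mu \<and> (i + 1, c) \<in> skew_diagram lam mu \<and>
        Max (decode t (i, c)) = Min (decode t (i + 1, c)) \<longleftrightarrow>
      c \<in> Suc ` {j. inner j (2 * i + 1) \<and> (t j = 2 * i + 1) = False}" for c
  proof (cases c)
    case 0
    then show ?thesis by (simp add: in_diagram)
  next
    case (Suc j)
    have "Max (decode t (i, Suc j)) = Min (decode t (i + 1, Suc j)) \<longleftrightarrow> t j \<noteq> 2 * i + 1"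
      if "inner j (2 * i + 1)"
      using both[of j] that Max_box_eq_Min_box_iff[of i "t j"] by (simp add: decode_def)
    then show ?thesis using both[of j] unfolding Suc by (simp add: inj_image_mem_iff) blast
  qed
  then have "{c. (i, c) \<in> skew_diagram lam mu \<and> (i + 1, c) \<in> skew_diagram lam mu \<and>
        Max (decode t (i, c)) = Min (decode t (i + 1, c))} =
      Suc ` {j. inner j (2 * i + 1) \<and> (t j = 2 * i + 1) = False}"
    by blast
  then show ?thesis unfolding ceq_def by (simp add: card_image)
qed

text \<open>A box contributes 1 if the transition falls into it and 0 otherwise.\<close>

lemma ex_decode: "ex lam mu (decode t) i = card {j. inner j (2 * i) \<and> (t j = 2 * i) = True}"
proof -
  have "j < lam 1" if "inner j (2 * i)" for j
    using lo_eq_hi[of j] that by (cases "j < lam 1") (auto simp: inner_def)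
  then have fin: "finite {j. inner j (2 * i)}"
    by (auto intro: finite_subset[of _ "{..<lam 1}"])
  have "{c. (i, c) \<in> skew_diagram lam mu} = Suc ` {j. inner j (2 * i)}"
    by (auto simp: in_diagram)
  then have "ex lam mu (decode t) i = (\<Sum>j | inner j (2 * i). card (decode t (i, Suc j)) - 1)"
    unfolding ex_def by (simp add: sum.reindex)
  also have "\<dots> = (\<Sum>j | inner j (2 * i). of_bool (t j = 2 * i))"
    by (intro sum.cong) (simp_all only: decode_Suc card_box mem_Collect_eq)
  also have "\<dots> = card {j. inner j (2 * i) \<and> (t j = 2 * i) = True}"
    using fin by (simp add: Collect_conj_eq)
  finally show ?thesis .
qed

section \<open>The involution on fillings\<close>

definition involution :: "(nat \<times> nat \<Rightarrow> nat set) \<Rightarrow> nat \<times> nat \<Rightarrow> nat set" where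
  "involution T = decode (switch (the_inv_into {t. valid t} decode T))"

lemma involution_decode: "valid t \<Longrightarrow> involution (decode t) = decode (switch t)"
  unfolding involution_def using the_inv_into_f_f[OF inj_decode] by simp

end

theorem theorem2p2:
  fixes lam mu :: "nat \<Rightarrow> nat"
  assumes "is_skew_shape lam mu"
  shows "\<exists>\<Phi> :: (nat \<times> nat \<Rightarrow> nat set) \<Rightarrow> (nat \<times> nat \<Rightarrow> nat set).
    \<forall>T \<in> SVRPP12 lam mu.
      \<Phi> T \<in> SVRPP12 lam mu \<and>
      \<Phi> (\<Phi> T) = T \<and>
      ceq lam mu (\<Phi> T) = ceq lam mu T \<and>
      ex lam mu (\<Phi> T) = ex lam mu T \<and>
      ircont lam mu (\<Phi> T) =
        (ircont lam mu T)(1 := ircont lam mu T 2, 2 := ircont lam mu T 1)"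
proof -
  interpret skew_shape lam mu by standard (rule assms)
  show ?thesis
  proof (intro exI ballI)
    fix T
    assume "T \<in> SVRPP12 lam mu"
    then obtain t where t: "valid t" and T: "T = decode t"
      using SVRPP12_decode by blast
    let ?u = "switch t"
    have u: "valid ?u" "switch ?u = t"
      using t switch(2) switch_switch by blast+
    \<comment> \<open>For \<open>k\<close> other than 1 and 2 both sides vanish.\<close>
    have "ircont lam mu (decode ?u) k =
        ((ircont lam mu T)(1 := ircont lam mu T 2, 2 := ircont lam mu T 1)) k" for k
      using ircont_decode_1[OF t] ircont_decode_1[OF u(1)]
        ircont_decode_2[OF t] ircont_decode_2[OF u(1)]
        card_switch_lo[OF t] card_switch_hi[OF t] ircont_decode_other[of k]
      unfolding T by (cases "k = 1"; cases "k = 2") simp_all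
    then have "ircont lam mu (decode ?u) =
        (ircont lam mu T)(1 := ircont lam mu T 2, 2 := ircont lam mu T 1)"
      by (rule ext)
    moreover have "ceq lam mu (decode ?u) = ceq lam mu T" "ex lam mu (decode ?u) = ex lam mu T"
      by (rule ext, simp only: T ceq_decode ex_decode card_switch_inner[OF t])+
    moreover have "involution T = decode ?u" "involution (decode ?u) = T"
      using involution_decode t u T by simp_all
    ultimately show "involution T \<in> SVRPP12 lam mu \<and> involution (involution T) = T \<and>
        ceq lam mu (involution T) = ceq lam mu T \<and> ex lam mu (involution T) = ex lam mu T \<and>
        ircont lam mu (involution T) =
          (ircont lam mu T)(1 := ircont lam mu T 2, 2 := ircont lam mu T 1)"
      using decode_in_SVRPP12[OF u(1)] by simp
  qed
qed

end
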